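(* Let $G$ be a compact, totally disconnected, and metrizable topological group. Then the dimension of a (symmetric) random walk on $G$ is zero: $\mathrm{d}_{RW}^G=0$.
   Context: Dimension of a symmetric random walk: let $G$ be a compact group (more generally a compact quantum group) with Haar state $\mathfrak{h}$ on $C(G)$. Let $\mathcal{R}_{\mathrm{sym}}(G)$ be the set of finite-dimensional representations $\chi$ of $G$ with $\chi=\overline{\chi}$ (i.e. equivalent to the conjugate representation). For $\chi=(\chi_{ij})\in\mathcal{R}_{\mathrm{sym}}(G)$ with $\dim\chi=k$ and $n\in\mathbb{N}$, put $$p_n^{\chi}=\frac{1}{k^{2n}}\,\mathfrak{h}\big((\chi_{11}+\chi_{22}+\cdots+\chi_{kk})^{2n}\big),$$ and define $$\mathrm{d}_{RW}^G=\sup_{\chi\in\mathcal{R}_{\mathrm{sym}}(G)}\Big(\limsup_{n\to\infty}\frac{-2\log p_n^{\chi}}{\log n}\Big).$$ *)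

theory Defs
  imports
    "HOL-Analysis.Analysis"
    "HOL-Algebra.Group"
    "Jordan_Normal_Form.Matrix"
begin

definition topological_group :: "('a, 'b) monoid_scheme \<Rightarrow> 'a topology \<Rightarrow> bool" where
  "topological_group G X \<longleftrightarrow>
     group G \<and> topspace X = carrier G \<and>
     continuous_map (prod_topology X X) X (\<lambda>(x, y). x \<otimes>\<^bsub>G\<^esub> y) \<and>
     continuous_map X X (\<lambda>x. inv\<^bsub>G\<^esub> x)"

definition totally_disconnected_space :: "'a topology \<Rightarrow> bool" where
  "totally_disconnected_space X \<longleftrightarrow> (\<forall>S. connectedin X S \<longrightarrow> (\<exists>x. S \<subseteq> {x}))"

text \<open>
  Elements of \<open>C(G)\<close> are represented by total functions \<open>'a \<Rightarrow> complex\<close> that are continuous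
  on \<open>X\<close>; the first clause below makes \<open>h\<close> well defined on \<open>C(G)\<close>, i.e. independent of the
  values outside the carrier. The remaining clauses say that \<open>h\<close> is a state (linear, unital,
  and positive on all \<open>f f\<^sup>*\<close>) that is invariant under left and right translation. On a compact
  Hausdorff group exactly one such functional on \<open>C(G)\<close> exists, namely integration against the
  normalised Haar measure.
\<close>

definition haar_state ::
    "('a, 'b) monoid_scheme \<Rightarrow> 'a topology \<Rightarrow> (('a \<Rightarrow> complex) \<Rightarrow> complex) \<Rightarrow> bool" where
  "haar_state G X h \<longleftrightarrow>
     (\<forall>f g. continuous_map X euclidean f \<longrightarrow> (\<forall>x\<in>carrier G. f x = g x) \<longrightarrow> h f = h g) \<and>
     (\<forall>f g. continuous_map X euclidean f \<longrightarrow> continuous_map X euclidean g \<longrightarrow>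
        h (\<lambda>x. f x + g x) = h f + h g) \<and>
     (\<forall>f c. continuous_map X euclidean f \<longrightarrow> h (\<lambda>x. c * f x) = c * h f) \<and>
     h (\<lambda>x. 1) = 1 \<and>
     (\<forall>f. continuous_map X euclidean f \<longrightarrow> h (\<lambda>x. f x * cnj (f x)) \<in> \<real>\<^sub>\<ge>\<^sub>0) \<and>
     (\<forall>f. \<forall>s\<in>carrier G. continuous_map X euclidean f \<longrightarrow>
        h (\<lambda>x. f (s \<otimes>\<^bsub>G\<^esub> x)) = h f \<and> h (\<lambda>x. f (x \<otimes>\<^bsub>G\<^esub> s)) = h f)"

definition fd_rep ::
    "('a, 'b) monoid_scheme \<Rightarrow> 'a topology \<Rightarrow> nat \<Rightarrow> ('a \<Rightarrow> complex mat) \<Rightarrow> bool" where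
  "fd_rep G X k \<rho> \<longleftrightarrow>
     (\<forall>x\<in>carrier G. \<rho> x \<in> carrier_mat k k) \<and>
     \<rho> \<one>\<^bsub>G\<^esub> = 1\<^sub>m k \<and>
     (\<forall>x\<in>carrier G. \<forall>y\<in>carrier G. \<rho> (x \<otimes>\<^bsub>G\<^esub> y) = \<rho> x * \<rho> y) \<and>
     (\<forall>i<k. \<forall>j<k. continuous_map X euclidean (\<lambda>x. \<rho> x $$ (i, j)))"

definition rep_equivalent ::
    "('a, 'b) monoid_scheme \<Rightarrow> nat \<Rightarrow> ('a \<Rightarrow> complex mat) \<Rightarrow> ('a \<Rightarrow> complex mat) \<Rightarrow> bool" where
  "rep_equivalent G k \<rho> \<psi> \<longleftrightarrow>
     (\<exists>T\<in>carrier_mat k k. invertible_mat T \<and> (\<forall>x\<in>carrier G. T * \<rho> x = \<psi> x * T))"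

definition conj_rep :: "('a \<Rightarrow> complex mat) \<Rightarrow> 'a \<Rightarrow> complex mat" where
  "conj_rep \<rho> = (\<lambda>x. map_mat cnj (\<rho> x))"

text \<open>
  A representation is paired with its dimension, so that the supremum in \<open>d_RW\<close> ranges over
  all dimensions; the zero-dimensional representation is excluded.
\<close>

definition sym_reps ::
    "('a, 'b) monoid_scheme \<Rightarrow> 'a topology \<Rightarrow> (nat \<times> ('a \<Rightarrow> complex mat)) set" where
  "sym_reps G X = {(k, \<rho>). k \<ge> 1 \<and> fd_rep G X k \<rho> \<and> rep_equivalent G k \<rho> (conj_rep \<rho>)}"

text \<open>
  The character of a representation in \<open>sym_reps\<close> is real-valued, hence so is the complex
  number whose real part is taken here.
\<close>

definition return_prob ::
    "(('a \<Rightarrow> complex) \<Rightarrow> complex) \<Rightarrow> nat \<Rightarrow> ('a \<Rightarrow> complex mat) \<Rightarrow> nat \<Rightarrow> real" where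
  "return_prob h k \<rho> n =
     Re (1 / of_nat k ^ (2 * n) * h (\<lambda>x. (\<Sum>i<k. \<rho> x $$ (i, i)) ^ (2 * n)))"

definition d_RW ::
    "('a, 'b) monoid_scheme \<Rightarrow> 'a topology \<Rightarrow> (('a \<Rightarrow> complex) \<Rightarrow> complex) \<Rightarrow> ereal" where
  "d_RW G X h =
     (SUP (k, \<rho>) \<in> sym_reps G X.
        limsup (\<lambda>n. ereal (- 2 * ln (return_prob h k \<rho> n) / ln (real n))))"

end

theory Submission imports Defs
begin

text \<open>
  A continuous finite-dimensional representation is trivial on some clopen submonoid \<open>N\<close>, because
  \<open>GL\<^sub>k\<close> has no small submonoids. There the character takes its maximal value
  \<open>k\<close>, and finitely many translates of \<open>N\<close> cover the group, so the return probabilities are bounded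
  below by a positive constant. Hence every limit superior is at most \<open>0\<close>, and the trivial
  representation attains \<open>0\<close>.
\<close>

section \<open>Clopen neighbourhoods and clopen submonoids\<close>

lemma continuous_map_of_real:
  "continuous_map X euclideanreal f \<Longrightarrow> continuous_map X euclidean (\<lambda>x. complex_of_real (f x))"
  by (simp add: continuous_map_atin tendsto_of_real)

lemma continuous_map_Re:
  "continuous_map X euclidean f \<Longrightarrow> continuous_map X euclideanreal (\<lambda>x. Re (f x))"
  by (simp add: continuous_map_atin tendsto_Re)

lemma continuous_map_indicator_clopen:
  assumes "openin X U" "closedin X U"
  shows "continuous_map X euclideanreal (indicator U)"
proof -
  have "openin X {x \<in> topspace X. indicator U x \<in> S}" for S :: "real set"
  proof -
    have "{x \<in> topspace X. indicator U x \<in> S} =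
        (if 1 \<in> S then U else {}) \<union> (if 0 \<in> S then topspace X - U else {})"
      using openin_subset[OF assms(1)] by (auto simp: indicator_def split: if_splits)
    then show ?thesis
      using assms by auto
  qed
  then show ?thesis
    by (simp add: continuous_map_def)
qed

text \<open>In a compact Hausdorff space components and quasi-components coincide, so total
  disconnectedness makes \<open>{a}\<close> a quasi-component. The complement of \<open>V\<close> is
  compact, and a quasi-component can be separated from a compact set disjoint from it; the side
  containing \<open>a\<close> is the clopen set sought.\<close>

lemma clopen_neighbourhood_in_totally_disconnected_space:
  assumes "compact_space X" "Hausdorff_space X" "totally_disconnected_space X"
    and "openin X V" "a \<in> V"
  obtains U where "openin X U" "closedin X U" "a \<in> U" "U \<subseteq> V"
proof -
  have a: "a \<in> topspace X"
    using assms openin_subset by blast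
  have "connectedin X (connected_component_of_set X a)"
    by (rule connectedin_connected_component_of)
  then obtain b where "connected_component_of_set X a \<subseteq> {b}"
    using assms(3) unfolding totally_disconnected_space_def by blast
  moreover have "a \<in> connected_component_of_set X a"
    using a by (simp add: connected_component_of_refl)
  ultimately have "connected_component_of_set X a = {a}"
    by blast
  then have "{a} \<in> connected_components_of X"
    unfolding connected_components_of_def using a by (metis imageI)
  then have "{a} \<in> quasi_components_of X"
    using quasi_eq_connected_components_of assms by blast
  moreover have "compactin X (topspace X - V)"
    using assms by (intro closedin_compact_space) auto
  ultimately have "separated_between X {a} (topspace X - V)"
    using assms(5) by (simp add: separated_between_quasi_component_compact disjnt_def)
  then obtain A B where AB: "openin X A" "openin X B" "A \<union> B = topspace X" "disjnt A B"
      "{a} \<subseteq> A" "topspace X - V \<subseteq> B"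
    by (meson separated_between_def)
  have "A = topspace X - B"
    using AB by (auto simp: disjnt_def)
  then have "closedin X A"
    using AB(2) by auto
  moreover have "A \<subseteq> V"
    using AB \<open>A = topspace X - B\<close> by auto
  ultimately show ?thesis
    using that AB by blast
qed

text \<open>For a clopen neighbourhood \<open>U\<close> of the identity, the stabiliser \<open>{x. U x \<subseteq> U}\<close> works.\<close>

lemma clopen_submonoid_in_neighbourhood:
  assumes "topological_group G X" "compact_space X" "Hausdorff_space X"
    and "totally_disconnected_space X" "openin X V" "\<one>\<^bsub>G\<^esub> \<in> V"
  obtains N where "openin X N" "closedin X N" "\<one>\<^bsub>G\<^esub> \<in> N" "N \<subseteq> V"
    "\<And>x y. x \<in> N \<Longrightarrow> y \<in> N \<Longrightarrow> x \<otimes>\<^bsub>G\<^esub> y \<in> N"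
proof -
  interpret group G
    using assms by (simp add: topological_group_def)
  have top: "topspace X = carrier G"
    and mult: "continuous_map (prod_topology X X) X (\<lambda>(x, y). x \<otimes>\<^bsub>G\<^esub> y)"
    using assms by (auto simp: topological_group_def)
  obtain U where U: "openin X U" "closedin X U" "\<one>\<^bsub>G\<^esub> \<in> U" "U \<subseteq> V"
    using clopen_neighbourhood_in_totally_disconnected_space assms by metis
  have UG: "U \<subseteq> carrier G"
    using U openin_subset top by blast
  define N where "N = {x \<in> carrier G. \<forall>u\<in>U. u \<otimes>\<^bsub>G\<^esub> x \<in> U}"
  have "closedin X N"
  proof -
    have "continuous_map X X (\<lambda>x. u \<otimes>\<^bsub>G\<^esub> x)" if "u \<in> U" for u
    proof -
      have "continuous_map X (prod_topology X X) (\<lambda>x. (u, x))"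
        using that UG top by (auto intro!: continuous_map_pairedI)
      from continuous_map_compose[OF this mult] show ?thesis
        by (simp add: o_def)
    qed
    then have "closedin X {x \<in> topspace X. u \<otimes>\<^bsub>G\<^esub> x \<in> U}" if "u \<in> U" for u
      using that U(2) closedin_continuous_map_preimage by blast
    \<comment> \<open>Each condition \<open>u \<otimes> x \<in> U\<close> is closed in
      \<open>x\<close> because \<open>U\<close> is closed. The identity lies in \<open>U\<close>, so
      the family being intersected is nonempty.\<close>
    moreover have "N = (\<Inter>u\<in>U. {x \<in> topspace X. u \<otimes>\<^bsub>G\<^esub> x \<in> U})"
      unfolding N_def using U(3) top by auto
    ultimately show ?thesis
      using U(3) by (auto intro!: closedin_Inter)
  qed
  moreover have "openin X N"
  proof -
    \<comment> \<open>\<open>C\<close> is the closed set of pairs \<open>(u, x)\<close> with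
      \<open>u\<close> in \<open>U\<close> and \<open>u \<otimes> x\<close> outside
      \<open>U\<close>; here \<open>U\<close> is used both as a closed and as an open set. Its
      projection to the second factor is the complement of \<open>N\<close>, and projecting along a
      compact factor is a closed map.\<close>
    define C where "C = {p \<in> topspace (prod_topology X X).
        (case p of (u, x) \<Rightarrow> u \<otimes>\<^bsub>G\<^esub> x) \<in> topspace X - U} \<inter> U \<times> topspace X"
    have "closedin (prod_topology X X) C"
      unfolding C_def
      using U by (intro closedin_Int closedin_continuous_map_preimage[OF mult])
        (auto simp: closedin_prod_Times_iff)
    then have "closedin X (snd ` C)"
      using closed_map_snd[OF assms(2)] by (auto simp: closed_map_def)
    moreover have "N = topspace X - snd ` C"
    proof (intro equalityI subsetI)
      fix x assume "x \<in> N"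
      then show "x \<in> topspace X - snd ` C"
        unfolding N_def C_def top by auto
    next
      fix x assume x: "x \<in> topspace X - snd ` C"
      have "u \<otimes>\<^bsub>G\<^esub> x \<in> U" if "u \<in> U" for u
      proof (rule ccontr)
        assume "u \<otimes>\<^bsub>G\<^esub> x \<notin> U"
        then have "(u, x) \<in> C"
          using that x UG unfolding C_def top by (auto simp: top)
        then show False
          using x by force
      qed
      then show "x \<in> N"
        using x unfolding N_def top by blast
    qed
    ultimately show ?thesis
      by auto
  qed
  moreover have "\<one>\<^bsub>G\<^esub> \<in> N"
    unfolding N_def using UG by auto
  \<comment> \<open>Taking \<open>u\<close> to be the identity in the definition of \<open>N\<close>
    gives \<open>x \<in> U\<close>.\<close>
  moreover have "N \<subseteq> V"
    unfolding N_def using U(3,4) by force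
  moreover have "x \<otimes>\<^bsub>G\<^esub> y \<in> N" if "x \<in> N" "y \<in> N" for x y
    using that UG unfolding N_def by (auto simp: m_assoc[symmetric] subset_iff)
  ultimately show ?thesis
    using that by blast
qed

section \<open>Matrices close to the identity\<close>

definition entry_norm :: "complex mat \<Rightarrow> real" where
  "entry_norm A = (\<Sum>i<dim_row A. \<Sum>j<dim_col A. cmod (A $$ (i, j)))"

lemma entry_norm_nonneg: "0 \<le> entry_norm A"
  by (simp add: entry_norm_def sum_nonneg)

lemma entry_norm_triangle:
  assumes "A \<in> carrier_mat k k" "B \<in> carrier_mat k k"
  shows "entry_norm (A + B) \<le> entry_norm A + entry_norm B"
  using assms
  by (auto simp: entry_norm_def sum.distrib[symmetric] intro!: sum_mono norm_triangle_ineq)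

lemma entry_norm_smult: "entry_norm (c \<cdot>\<^sub>m A) = cmod c * entry_norm A"
  by (simp add: entry_norm_def sum_distrib_left norm_mult)

text \<open>Submultiplicativity without a dimension factor is the reason for summing the absolute
  values of all entries; their maximum would cost a factor \<open>k\<close>.\<close>

lemma entry_norm_mult:
  assumes A: "A \<in> carrier_mat k k" and B: "B \<in> carrier_mat k k"
  shows "entry_norm (A * B) \<le> entry_norm A * entry_norm B"
proof -
  have "entry_norm (A * B) = (\<Sum>i<k. \<Sum>j<k. cmod (\<Sum>l<k. A $$ (i, l) * B $$ (l, j)))"
    using A B by (auto simp: entry_norm_def scalar_prod_def lessThan_atLeast0 intro!: sum.cong)
  also have "\<dots> \<le> (\<Sum>i<k. \<Sum>j<k. \<Sum>l<k. cmod (A $$ (i, l)) * cmod (B $$ (l, j)))"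
    by (intro sum_mono sum_norm_le) (simp add: norm_mult)
  also have "\<dots> = (\<Sum>i<k. \<Sum>l<k. cmod (A $$ (i, l)) * (\<Sum>j<k. cmod (B $$ (l, j))))"
    by (subst sum.swap) (simp add: sum_distrib_left)
  \<comment> \<open>Each row sum of \<open>B\<close> is a single term of the outer sum of
    nonnegative terms that makes up \<open>entry_norm B\<close>.\<close>
  also have "\<dots> \<le> (\<Sum>i<k. \<Sum>l<k. cmod (A $$ (i, l)) * entry_norm B)"
  proof (intro sum_mono mult_left_mono)
    fix l assume "l \<in> {..<k}"
    then show "(\<Sum>j<k. cmod (B $$ (l, j))) \<le> entry_norm B"
      using B member_le_sum[of l "{..<k}" "\<lambda>l. \<Sum>j<k. cmod (B $$ (l, j))"]
      by (auto simp: entry_norm_def sum_nonneg)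
  qed auto
  also have "\<dots> = entry_norm A * entry_norm B"
    using A by (simp add: entry_norm_def sum_distrib_right)
  finally show ?thesis .
qed

text \<open>With \<open>B = A - 1\<close> we have \<open>A\<^sup>2 - 1 = 2 B + B\<^sup>2\<close>, so squaring pushes \<open>A\<close> away from \<open>1\<close>.\<close>

lemma entry_norm_square_minus_one:
  assumes A: "A \<in> carrier_mat k k" and small: "entry_norm (A - 1\<^sub>m k) \<le> 1 / 2"
  shows "3 / 2 * entry_norm (A - 1\<^sub>m k) \<le> entry_norm (A * A - 1\<^sub>m k)"
proof -
  define B where "B = A - 1\<^sub>m k"
  define C where "C = A * A - 1\<^sub>m k"
  have carr: "B \<in> carrier_mat k k" "C \<in> carrier_mat k k"
    using A by (auto simp: B_def C_def)
  have "B * B = A * B - 1\<^sub>m k * B"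
    using A carr minus_mult_distrib_mat[of A k k "1\<^sub>m k" B k] by (simp add: B_def)
  also have "A * B = A * A - A"
    using A mult_minus_distrib_mat[of A k k A k "1\<^sub>m k"] by (simp add: B_def)
  finally have BB: "B * B = A * A - A - (A - 1\<^sub>m k)"
    using carr by (simp add: B_def)
  have "2 \<cdot>\<^sub>m B = C + (- 1) \<cdot>\<^sub>m (B * B)"
    unfolding BB using A by (intro eq_matI) (auto simp: B_def C_def)
  then have "2 * entry_norm B \<le> entry_norm C + entry_norm (B * B)"
    using entry_norm_triangle[of C k "(- 1) \<cdot>\<^sub>m (B * B)"] carr
    by (metis entry_norm_smult mult_carrier_mat norm_minus_cancel norm_numeral norm_one
        mult_1 smult_carrier_mat)
  moreover have "entry_norm (B * B) \<le> entry_norm B * entry_norm B"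
    using carr by (intro entry_norm_mult)
  \<comment> \<open>The bound 1/2 absorbs the quadratic term into half of the linear one, leaving
    the factor 2 - 1/2 = 3/2.\<close>
  moreover have "entry_norm B * entry_norm B \<le> 1 / 2 * entry_norm B"
    using small by (intro mult_right_mono) (auto simp: B_def entry_norm_nonneg)
  ultimately show ?thesis
    by (simp add: B_def C_def)
qed

text \<open>Repeated squaring stays in \<open>S\<close> and multiplies the distance to the identity
  by at least 3/2 each time. A nonzero distance would therefore eventually exceed 1/2.\<close>

lemma no_small_submonoids:
  assumes carr: "\<And>A. A \<in> S \<Longrightarrow> A \<in> carrier_mat k k"
    and small: "\<And>A. A \<in> S \<Longrightarrow> entry_norm (A - 1\<^sub>m k) \<le> 1 / 2"
    and closed: "\<And>A. A \<in> S \<Longrightarrow> A * A \<in> S"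
    and "A \<in> S"
  shows "A = 1\<^sub>m k"
proof -
  \<comment> \<open>The intended witness is \<open>A\<close> raised to the power 2^n; the
    existential form avoids matrix powers.\<close>
  have grow: "\<exists>B\<in>S. (3 / 2) ^ n * entry_norm (A - 1\<^sub>m k) \<le> entry_norm (B - 1\<^sub>m k)" for n
  proof (induction n)
    case 0
    then show ?case
      using \<open>A \<in> S\<close> by auto
  next
    case (Suc n)
    then obtain B where B: "B \<in> S"
        "(3 / 2) ^ n * entry_norm (A - 1\<^sub>m k) \<le> entry_norm (B - 1\<^sub>m k)"
      by blast
    have "3 / 2 * entry_norm (B - 1\<^sub>m k) \<le> entry_norm (B * B - 1\<^sub>m k)"
      using B carr small by (intro entry_norm_square_minus_one) auto
    then show ?case
      using B closed by (intro bexI[of _ "B * B"]) auto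
  qed
  have "entry_norm (A - 1\<^sub>m k) = 0"
  proof (rule ccontr)
    assume "entry_norm (A - 1\<^sub>m k) \<noteq> 0"
    then have pos: "entry_norm (A - 1\<^sub>m k) > 0"
      using entry_norm_nonneg[of "A - 1\<^sub>m k"] by linarith
    obtain n where "1 / 2 / entry_norm (A - 1\<^sub>m k) < (3 / 2 :: real) ^ n"
      using real_arch_pow[of "3 / 2"] by auto
    then have "1 / 2 < (3 / 2) ^ n * entry_norm (A - 1\<^sub>m k)"
      using pos by (simp add: field_simps)
    then show False
      using grow[of n] small by force
  qed
  then have "(A - 1\<^sub>m k) $$ (i, j) = 0" if "i < k" "j < k" for i j
    using that carr[OF \<open>A \<in> S\<close>]
    by (simp add: entry_norm_def sum_nonneg sum_nonneg_eq_0_iff)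
  then show ?thesis
    using carr[OF \<open>A \<in> S\<close>] by (intro eq_matI) auto
qed

text \<open>The points whose matrices lie within 1/2 of the identity form an open neighbourhood of
  the unit. A clopen submonoid inside it has a multiplicatively closed image near the identity
  matrix, which must be trivial.\<close>

lemma fd_rep_trivial_on_clopen_set:
  assumes "topological_group G X" "compact_space X" "Hausdorff_space X"
    and "totally_disconnected_space X" and rep: "fd_rep G X k \<rho>"
  obtains N where "openin X N" "closedin X N" "\<one>\<^bsub>G\<^esub> \<in> N" "\<And>x. x \<in> N \<Longrightarrow> \<rho> x = 1\<^sub>m k"
proof -
  interpret group G
    using assms by (simp add: topological_group_def)
  have top: "topspace X = carrier G"
    using assms by (simp add: topological_group_def)
  \<comment> \<open>\<open>D\<close> writes the norm with fixed index ranges, so its continuity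
    follows from that of the entries. It is identified with \<open>entry_norm\<close> on the
    carrier, where \<open>\<rho> x\<close> is known to be a \<open>k\<close> by \<open>k\<close>
    matrix.\<close>
  define D where "D = (\<lambda>x. \<Sum>i<k. \<Sum>j<k. cmod (\<rho> x $$ (i, j) - 1\<^sub>m k $$ (i, j)))"
  have D: "entry_norm (\<rho> x - 1\<^sub>m k) = D x" if "x \<in> carrier G" for x
    using that rep by (auto simp: D_def entry_norm_def fd_rep_def intro!: sum.cong)
  define V where "V = {x \<in> topspace X. D x \<in> {..<1 / 2}}"
  have "continuous_map X euclideanreal D"
    unfolding D_def using rep by (intro continuous_intros) (auto simp: fd_rep_def)
  then have "openin X V"
    unfolding V_def by (rule openin_continuous_map_preimage) auto
  moreover have "\<one>\<^bsub>G\<^esub> \<in> V"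
    using rep by (simp add: V_def top D_def fd_rep_def)
  ultimately obtain N where N: "openin X N" "closedin X N" "\<one>\<^bsub>G\<^esub> \<in> N" "N \<subseteq> V"
      "\<And>x y. x \<in> N \<Longrightarrow> y \<in> N \<Longrightarrow> x \<otimes>\<^bsub>G\<^esub> y \<in> N"
    using clopen_submonoid_in_neighbourhood[OF assms(1-4)] by metis
  have sub: "x \<in> carrier G" "D x \<le> 1 / 2" if "x \<in> N" for x
    using that N(4) by (auto simp: V_def top)
  have "\<rho> x = 1\<^sub>m k" if "x \<in> N" for x
  proof (rule no_small_submonoids[of "\<rho> ` N"])
    show "A \<in> carrier_mat k k" if "A \<in> \<rho> ` N" for A
      using that sub rep by (auto simp: fd_rep_def)
    show "entry_norm (A - 1\<^sub>m k) \<le> 1 / 2" if "A \<in> \<rho> ` N" for A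
      using that sub D by auto
    show "A * A \<in> \<rho> ` N" if "A \<in> \<rho> ` N" for A
    proof -
      obtain y where y: "y \<in> N" "A = \<rho> y"
        using \<open>A \<in> \<rho> ` N\<close> by blast
      then have "A * A = \<rho> (y \<otimes>\<^bsub>G\<^esub> y)"
        using sub rep by (simp add: fd_rep_def)
      then show ?thesis
        using N(5) y by blast
    qed
  qed (use that in auto)
  then show ?thesis
    using that N by blast
qed

section \<open>The Haar state as a monotone mean on real functions\<close>

lemma haar_state_cong:
  assumes "haar_state G X h" "continuous_map X euclidean f" "\<And>x. x \<in> carrier G \<Longrightarrow> f x = g x"
  shows "h f = h g"
proof -
  have "\<forall>f g. continuous_map X euclidean f \<longrightarrow> (\<forall>x\<in>carrier G. f x = g x) \<longrightarrow> h f = h g"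
    using assms(1) unfolding haar_state_def by (elim conjE)
  from this[rule_format, OF assms(2), of g] show ?thesis
    using assms(3) by metis
qed

lemma haar_state_square:
  assumes "haar_state G X h" "continuous_map X euclidean f"
  shows "h (\<lambda>x. f x * cnj (f x)) \<in> \<real>\<^sub>\<ge>\<^sub>0"
proof -
  have "\<forall>f. continuous_map X euclidean f \<longrightarrow> h (\<lambda>x. f x * cnj (f x)) \<in> \<real>\<^sub>\<ge>\<^sub>0"
    using assms(1) unfolding haar_state_def by (elim conjE)
  from this[rule_format, OF assms(2)] show ?thesis .
qed

text \<open>Passing to real functions and real values makes the usual order available, so integrals
  can be compared.\<close>

definition haar_mean :: "(('a \<Rightarrow> complex) \<Rightarrow> complex) \<Rightarrow> ('a \<Rightarrow> real) \<Rightarrow> real" where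
  "haar_mean h f = Re (h (\<lambda>x. complex_of_real (f x)))"

context
  fixes G :: "('a, 'b) monoid_scheme" and X :: "'a topology" and h
  assumes top: "topspace X = carrier G" and haar: "haar_state G X h"
begin

lemma haar_mean_add:
  assumes "continuous_map X euclideanreal f" "continuous_map X euclideanreal g"
  shows "haar_mean h (\<lambda>x. f x + g x) = haar_mean h f + haar_mean h g"
  using haar assms[THEN continuous_map_of_real] by (simp add: haar_mean_def haar_state_def)

lemma haar_mean_cmult:
  assumes "continuous_map X euclideanreal f"
  shows "haar_mean h (\<lambda>x. c * f x) = c * haar_mean h f"
  using haar assms[THEN continuous_map_of_real] by (simp add: haar_mean_def haar_state_def)

lemma haar_mean_one: "haar_mean h (\<lambda>x. 1) = 1"
  using haar by (simp add: haar_mean_def haar_state_def)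

lemma haar_mean_translate:
  assumes "continuous_map X euclideanreal f" "s \<in> carrier G"
  shows "haar_mean h (\<lambda>x. f (s \<otimes>\<^bsub>G\<^esub> x)) = haar_mean h f"
proof -
  have "h (\<lambda>x. g (s \<otimes>\<^bsub>G\<^esub> x)) = h g" if "continuous_map X euclidean g" for g
    using haar assms(2) that by (simp add: haar_state_def)
  from this[OF continuous_map_of_real[OF assms(1)]] show ?thesis
    by (simp add: haar_mean_def)
qed

text \<open>A state is given as positive only on products \<open>f x * cnj (f x)\<close>. A
  nonnegative function has this form via its square root; on the carrier the two sides agree, which
  suffices by \<open>haar_state_cong\<close>.\<close>

lemma haar_mean_nonneg:
  assumes f: "continuous_map X euclideanreal f" and nonneg: "\<And>x. x \<in> carrier G \<Longrightarrow> 0 \<le> f x"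
  shows "0 \<le> haar_mean h f"
proof -
  let ?g = "\<lambda>x. complex_of_real (sqrt (f x))"
  have "continuous_map X euclideanreal (\<lambda>x. sqrt (f x))"
    using f by (simp add: continuous_map_atin tendsto_real_sqrt)
  then have "h (\<lambda>x. ?g x * cnj (?g x)) \<in> \<real>\<^sub>\<ge>\<^sub>0"
    by (intro haar_state_square[OF haar] continuous_map_of_real)
  moreover have "h (\<lambda>x. complex_of_real (f x)) = h (\<lambda>x. ?g x * cnj (?g x))"
    by (rule haar_state_cong[OF haar continuous_map_of_real[OF f]])
      (simp add: nonneg flip: of_real_mult)
  ultimately show ?thesis
    by (simp add: haar_mean_def complex_nonneg_Reals_iff)
qed

lemma haar_mean_mono:
  assumes f: "continuous_map X euclideanreal f" and g: "continuous_map X euclideanreal g"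
    and le: "\<And>x. x \<in> carrier G \<Longrightarrow> f x \<le> g x"
  shows "haar_mean h f \<le> haar_mean h g"
proof -
  have "0 \<le> haar_mean h (\<lambda>x. g x - f x)"
    using f g le by (intro haar_mean_nonneg continuous_intros) auto
  moreover have "haar_mean h (\<lambda>x. f x + (g x - f x)) = haar_mean h f + haar_mean h (\<lambda>x. g x - f x)"
    using f g by (intro haar_mean_add continuous_intros) auto
  ultimately show ?thesis
    by simp
qed

lemma haar_mean_sum:
  assumes "finite S" "\<And>s. s \<in> S \<Longrightarrow> continuous_map X euclideanreal (f s)"
  shows "haar_mean h (\<lambda>x. \<Sum>s\<in>S. f s x) = (\<Sum>s\<in>S. haar_mean h (f s))"
  using assms
proof (induction S rule: finite_induct)
  case empty
  show ?case
    \<comment> \<open>The empty sum is 0 times the constant function 1.\<close>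
    using haar_mean_cmult[of "\<lambda>x. 1" 0] by simp
next
  case (insert s S)
  then have "haar_mean h (\<lambda>x. f s x + (\<Sum>s\<in>S. f s x))
      = haar_mean h (f s) + haar_mean h (\<lambda>x. \<Sum>s\<in>S. f s x)"
    by (intro haar_mean_add continuous_map_sum) auto
  then show ?case
    using insert by simp
qed

text \<open>By compactness finitely many translates of \<open>N\<close> cover the group. Their
  indicators sum to at least 1, and by invariance each has the same mean as the indicator of
  \<open>N\<close>, so that mean cannot be 0 or negative.\<close>

lemma haar_mean_clopen_pos:
  assumes "topological_group G X" "compact_space X"
    and N: "openin X N" "closedin X N" "N \<noteq> {}"
  shows "0 < haar_mean h (indicator N)"
proof -
  interpret group G
    using assms by (simp add: topological_group_def)
  have NG: "N \<subseteq> carrier G"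
    using N openin_subset top by blast
  have trans: "continuous_map X X (\<lambda>x. s \<otimes>\<^bsub>G\<^esub> x)" if "s \<in> carrier G" for s
  proof -
    have "continuous_map X (prod_topology X X) (\<lambda>x. (s, x))"
      using that top by (auto intro!: continuous_map_pairedI)
    moreover have "continuous_map (prod_topology X X) X (\<lambda>(x, y). x \<otimes>\<^bsub>G\<^esub> y)"
      using assms by (simp add: topological_group_def)
    ultimately have "continuous_map X X ((\<lambda>(x, y). x \<otimes>\<^bsub>G\<^esub> y) \<circ> (\<lambda>x. (s, x)))"
      by (rule continuous_map_compose)
    then show ?thesis
      by (simp add: o_def)
  qed
  define T where "T = (\<lambda>s. {x \<in> topspace X. s \<otimes>\<^bsub>G\<^esub> x \<in> N})"
  have openT: "openin X (T s)" if "s \<in> carrier G" for s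
    unfolding T_def using trans[OF that] N(1) by (rule openin_continuous_map_preimage)
  have cover: "topspace X \<subseteq> (\<Union>s\<in>carrier G. T s)"
  proof
    fix x assume x: "x \<in> topspace X"
    obtain y where y: "y \<in> N"
      using N(3) by blast
    \<comment> \<open>Left translation by \<open>y x^{-1}\<close> carries \<open>x\<close> to the
      chosen point \<open>y\<close> of \<open>N\<close>, so the sets \<open>T s\<close>
      cover.\<close>
    then have "(y \<otimes>\<^bsub>G\<^esub> inv\<^bsub>G\<^esub> x) \<otimes>\<^bsub>G\<^esub> x = y"
      using x NG top by (auto simp: m_assoc subset_iff)
    then have "x \<in> T (y \<otimes>\<^bsub>G\<^esub> inv\<^bsub>G\<^esub> x)" "y \<otimes>\<^bsub>G\<^esub> inv\<^bsub>G\<^esub> x \<in> carrier G"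
      using x y NG top by (auto simp: T_def)
    then show "x \<in> (\<Union>s\<in>carrier G. T s)"
      by blast
  qed
  obtain \<F> where F: "finite \<F>" "\<F> \<subseteq> T ` carrier G" "topspace X \<subseteq> \<Union>\<F>"
    using compactinD[of X "topspace X" "T ` carrier G"] assms(2) openT cover
    by (auto simp: compact_space_def)
  obtain S where S: "S \<subseteq> carrier G" "finite S" "\<F> = T ` S"
    using finite_subset_image[OF F(1,2)] by blast
  define f :: "'a \<Rightarrow> 'a \<Rightarrow> real" where "f = (\<lambda>s x. indicator N (s \<otimes>\<^bsub>G\<^esub> x))"
  have ind: "continuous_map X euclideanreal (indicator N)"
    using N by (intro continuous_map_indicator_clopen)
  have f: "continuous_map X euclideanreal (f s)" if "s \<in> S" for s
    using continuous_map_compose[OF trans ind] S that by (auto simp: f_def o_def)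
  have "1 \<le> (\<Sum>s\<in>S. f s x)" if "x \<in> carrier G" for x
  proof -
    have "x \<in> \<Union>(T ` S)"
      using that F(3) S(3) top by blast
    then obtain s where s: "s \<in> S" "x \<in> T s"
      by blast
    then have "1 = f s x"
      by (simp add: T_def f_def)
    also have "\<dots> \<le> (\<Sum>s\<in>S. f s x)"
      using s S(2) by (intro member_le_sum) (auto simp: f_def)
    finally show ?thesis .
  qed
  then have "haar_mean h (\<lambda>x. 1) \<le> haar_mean h (\<lambda>x. \<Sum>s\<in>S. f s x)"
    using S f by (intro haar_mean_mono continuous_map_sum) auto
  also have "\<dots> = (\<Sum>s\<in>S. haar_mean h (f s))"
    using S f by (intro haar_mean_sum) auto
  also have "\<dots> = (\<Sum>s\<in>S. haar_mean h (indicator N))"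
    unfolding f_def using S ind by (intro sum.cong haar_mean_translate) auto
  finally have "1 \<le> real (card S) * haar_mean h (indicator N)"
    by (simp add: haar_mean_one)
  then show ?thesis
    by (smt (verit) mult_nonneg_nonpos of_nat_0_le_iff)
qed

end

section \<open>Characters of symmetric representations\<close>

lemma trace_mult_commute:
  fixes A B :: "complex mat"
  assumes "A \<in> carrier_mat k k" "B \<in> carrier_mat k k"
  shows "(\<Sum>i<k. (A * B) $$ (i, i)) = (\<Sum>i<k. (B * A) $$ (i, i))"
proof -
  have "(\<Sum>i<k. (A * B) $$ (i, i)) = (\<Sum>i<k. \<Sum>j<k. A $$ (i, j) * B $$ (j, i))"
    using assms by (auto simp: scalar_prod_def lessThan_atLeast0 intro!: sum.cong)
  also have "\<dots> = (\<Sum>j<k. \<Sum>i<k. B $$ (j, i) * A $$ (i, j))"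
    by (subst sum.swap) (simp add: mult.commute)
  also have "\<dots> = (\<Sum>i<k. (B * A) $$ (i, i))"
    using assms by (auto simp: scalar_prod_def lessThan_atLeast0 intro!: sum.cong)
  finally show ?thesis .
qed

lemma rep_equivalent_trace_eq:
  assumes "rep_equivalent G k \<rho> \<psi>" "x \<in> carrier G"
    and \<rho>: "\<rho> x \<in> carrier_mat k k" and \<psi>: "\<psi> x \<in> carrier_mat k k"
  shows "(\<Sum>i<k. \<rho> x $$ (i, i)) = (\<Sum>i<k. \<psi> x $$ (i, i))"
proof -
  obtain T where T: "T \<in> carrier_mat k k" "invertible_mat T" "T * \<rho> x = \<psi> x * T"
    using assms by (auto simp: rep_equivalent_def)
  then obtain S where ST: "S * T = 1\<^sub>m (dim_row S)" "T * S = 1\<^sub>m k"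
    by (auto simp: invertible_mat_def inverts_mat_def)
  \<comment> \<open>\<open>invertible_mat\<close> states one of the two identities with size
    \<open>dim_row S\<close>, so the dimensions of \<open>S\<close> must be recovered by comparing
    both products.\<close>
  have S: "S \<in> carrier_mat k k"
    by (metis ST T(1) carrier_matD carrier_matI index_mult_mat(2,3) index_one_mat(2,3))
  then have ST': "S * T = 1\<^sub>m k"
    using ST by simp
  have "\<rho> x = (S * T) * \<rho> x"
    using ST' \<rho> by simp
  also have "\<dots> = S * (\<psi> x * T)"
    using S T \<rho> by (simp add: assoc_mult_mat[of _ k k _ k _ k])
  finally have "(\<Sum>i<k. \<rho> x $$ (i, i)) = (\<Sum>i<k. ((\<psi> x * T) * S) $$ (i, i))"
    using trace_mult_commute[of S k "\<psi> x * T"] S T \<psi> by simp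
  also have "(\<psi> x * T) * S = \<psi> x"
    using S T \<psi> ST(2) by (simp add: assoc_mult_mat[of _ k k _ k _ k])
  finally show ?thesis .
qed

text \<open>Equivalence with the conjugate representation makes the trace equal to its own
  conjugate. Reality is what makes even powers of the character nonnegative.\<close>

lemma sym_reps_trace_real:
  assumes "(k, \<rho>) \<in> sym_reps G X" "x \<in> carrier G"
  shows "(\<Sum>i<k. \<rho> x $$ (i, i)) = complex_of_real (Re (\<Sum>i<k. \<rho> x $$ (i, i)))"
proof -
  have \<rho>: "\<rho> x \<in> carrier_mat k k" and eq: "rep_equivalent G k \<rho> (conj_rep \<rho>)"
    using assms by (auto simp: sym_reps_def fd_rep_def)
  then have "(\<Sum>i<k. \<rho> x $$ (i, i)) = (\<Sum>i<k. conj_rep \<rho> x $$ (i, i))"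
    using assms(2) by (intro rep_equivalent_trace_eq) (auto simp: conj_rep_def)
  also have "\<dots> = cnj (\<Sum>i<k. \<rho> x $$ (i, i))"
    using \<rho> by (simp add: conj_rep_def)
  finally show ?thesis
    by (metis Reals_cnj_iff of_real_Re)
qed

section \<open>Return probabilities and the dimension\<close>

lemma return_prob_bounded_below:
  assumes "topological_group G X" "compact_space X" "Hausdorff_space X"
    and "totally_disconnected_space X" and haar: "haar_state G X h"
    and sym: "(k, \<rho>) \<in> sym_reps G X"
  obtains c where "0 < c" "\<And>n. c \<le> return_prob h k \<rho> n"
proof -
  have top: "topspace X = carrier G"
    using assms by (simp add: topological_group_def)
  have k: "k \<ge> 1" and rep: "fd_rep G X k \<rho>"
    using sym by (auto simp: sym_reps_def)
  obtain N where N: "openin X N" "closedin X N" "\<one>\<^bsub>G\<^esub> \<in> N" "\<And>x. x \<in> N \<Longrightarrow> \<rho> x = 1\<^sub>m k"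
    using fd_rep_trivial_on_clopen_set[OF assms(1-4) rep] by metis
  define t where "t = (\<lambda>x. Re (\<Sum>i<k. \<rho> x $$ (i, i)))"
  have t: "continuous_map X euclideanreal (\<lambda>x. t x ^ m)" for m
    unfolding t_def using rep
    by (intro continuous_map_real_pow continuous_map_Re continuous_map_sum)
      (auto simp: fd_rep_def)
  have ind: "continuous_map X euclideanreal (indicator N)"
    using N by (intro continuous_map_indicator_clopen)
  have "haar_mean h (indicator N) \<le> return_prob h k \<rho> n" for n
  proof -
    \<comment> \<open>On \<open>N\<close> the trace is exactly \<open>k\<close>; elsewhere the left
      side is 0 and an even power of a real number is nonnegative. Dividing by \<open>k^(2n)\<close>
      later yields a bound independent of \<open>n\<close>, namely the Haar measure of
      \<open>N\<close>.\<close>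
    have "real k ^ (2 * n) * indicator N x \<le> t x ^ (2 * n)" if "x \<in> carrier G" for x
      using N(4) by (auto simp: indicator_def t_def)
    then have "haar_mean h (\<lambda>x. real k ^ (2 * n) * indicator N x) \<le> haar_mean h (\<lambda>x. t x ^ (2 * n))"
      using t ind by (intro haar_mean_mono[OF top haar] continuous_map_real_mult_left) auto
    then have "real k ^ (2 * n) * haar_mean h (indicator N) \<le> haar_mean h (\<lambda>x. t x ^ (2 * n))"
      by (simp add: haar_mean_cmult[OF top haar ind])
    moreover have "return_prob h k \<rho> n = haar_mean h (\<lambda>x. t x ^ (2 * n)) / real k ^ (2 * n)"
    proof -
      have "complex_of_real (t x ^ (2 * n)) = (\<Sum>i<k. \<rho> x $$ (i, i)) ^ (2 * n)"
        if "x \<in> carrier G" for x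
        using sym_reps_trace_real[OF sym that] by (simp add: t_def)
      then have "h (\<lambda>x. complex_of_real (t x ^ (2 * n))) = h (\<lambda>x. (\<Sum>i<k. \<rho> x $$ (i, i)) ^ (2 * n))"
        by (rule haar_state_cong[OF haar continuous_map_of_real[OF t]])
      then show ?thesis
        by (simp add: return_prob_def haar_mean_def Re_divide_of_real flip: of_real_power)
    qed
    ultimately show ?thesis
      using k by (simp add: pos_le_divide_eq mult.commute)
  qed
  moreover have "0 < haar_mean h (indicator N)"
    using N by (intro haar_mean_clopen_pos[OF top haar assms(1,2)]) auto
  ultimately show ?thesis
    using that by blast
qed

text \<open>The numerator is at most the constant \<open>- 2 * ln c\<close>, while the denominator
  tends to infinity.\<close>

lemma limsup_return_exponent_le_0:
  fixes p :: "nat \<Rightarrow> real"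
  assumes "0 < c" "\<And>n. c \<le> p n"
  shows "limsup (\<lambda>n. ereal (- 2 * ln (p n) / ln (real n))) \<le> 0"
proof -
  have "filterlim (\<lambda>n. ln (real n)) at_top sequentially"
    using ln_at_top filterlim_real_sequentially by (rule filterlim_compose)
  then have "((\<lambda>n. - 2 * ln c / ln (real n)) \<longlongrightarrow> 0) sequentially"
    by (intro tendsto_divide_0[OF tendsto_const] filterlim_at_top_imp_at_infinity)
  then have "limsup (\<lambda>n. ereal (- 2 * ln c / ln (real n))) = ereal 0"
    by (intro lim_imp_Limsup) auto
  \<comment> \<open>For \<open>n \<ge> 1\<close> the denominator is nonnegative, so division
    preserves the inequality; at \<open>n = 1\<close> both quotients are 0 by the convention for
    division by 0.\<close>
  moreover have "ereal (- 2 * ln (p n) / ln (real n)) \<le> ereal (- 2 * ln c / ln (real n))"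
    if "n \<ge> 1" for n
  proof -
    have "ln c \<le> ln (p n)"
      using assms(1) assms(2)[of n] by simp
    then show ?thesis
      using that by (intro ereal_less_eq(3)[THEN iffD2] divide_right_mono) auto
  qed
  then have "limsup (\<lambda>n. ereal (- 2 * ln (p n) / ln (real n)))
      \<le> limsup (\<lambda>n. ereal (- 2 * ln c / ln (real n)))"
    by (intro Limsup_mono eventually_sequentiallyI)
  ultimately show ?thesis
    by (simp add: zero_ereal_def)
qed

text \<open>This member supplies the lower bound for the supremum; the identity matrix serves as
  intertwiner with the conjugate.\<close>

lemma trivial_rep_in_sym_reps: "(1, \<lambda>x. 1\<^sub>m 1) \<in> sym_reps G X"
proof -
  have "rep_equivalent G 1 (\<lambda>x. 1\<^sub>m 1) (conj_rep (\<lambda>x. 1\<^sub>m 1))"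
    unfolding rep_equivalent_def
  proof (intro bexI conjI ballI)
    show "invertible_mat (1\<^sub>m 1 :: complex mat)"
      by (auto simp: invertible_mat_def inverts_mat_def intro!: exI[of _ "1\<^sub>m 1"])
    show "1\<^sub>m 1 * 1\<^sub>m 1 = conj_rep (\<lambda>x. 1\<^sub>m 1) x * 1\<^sub>m 1" for x :: 'a
      by (intro eq_matI) (auto simp: conj_rep_def)
  qed auto
  then show ?thesis
    by (simp add: sym_reps_def fd_rep_def)
qed

theorem corollary3p11:
  fixes G :: "('a, 'b) monoid_scheme"
    and X :: "'a topology"
    and h :: "('a \<Rightarrow> complex) \<Rightarrow> complex"
  assumes "topological_group G X"
    and "compact_space X"
    and "totally_disconnected_space X"
    and "metrizable_space X"
    and "haar_state G X h"
  shows "d_RW G X h = 0"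
proof (rule antisym)
  have Hausdorff: "Hausdorff_space X"
    using assms(4) by (rule metrizable_imp_Hausdorff_space)
  show "d_RW G X h \<le> 0"
    unfolding d_RW_def
  proof (intro SUP_least, clarify)
    fix k \<rho> assume "(k, \<rho>) \<in> sym_reps G X"
    then obtain c where "0 < c" "\<And>n. c \<le> return_prob h k \<rho> n"
      using return_prob_bounded_below assms(1-3,5) Hausdorff by metis
    then show "limsup (\<lambda>n. ereal (- 2 * ln (return_prob h k \<rho> n) / ln (real n))) \<le> 0"
      by (rule limsup_return_exponent_le_0)
  qed
  \<comment> \<open>The character is constantly 1 and \<open>h\<close> is unital. Since
    \<open>ln 1 = 0\<close>, the exponent of the trivial representation is 0, which keeps the
    supremum in \<open>ereal\<close> from being negative.\<close>
  have "return_prob h 1 (\<lambda>x. 1\<^sub>m 1) n = 1" for n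
    using assms(5) by (simp add: return_prob_def haar_state_def)
  then have "limsup (\<lambda>n. ereal (- 2 * ln (return_prob h 1 (\<lambda>x. 1\<^sub>m 1) n) / ln (real n))) = 0"
    by (simp add: Limsup_const flip: zero_ereal_def)
  then show "0 \<le> d_RW G X h"
    unfolding d_RW_def by (intro SUP_upper2[OF trivial_rep_in_sym_reps]) simp
qed

end
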